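(* Let $\mathcal{R}$ be an integral domain and let $\Gamma$ be a finite directed graph without loops and with at most one directed edge between any pair of vertices. Assume that $\Gamma$ is a union of two full subgraphs $\Gamma_1$ and $\Gamma_2$ such that $V(\Gamma_1)\cap V(\Gamma_2)=\{a\}$ for some vertex $a$ which is a source or a sink of $\Gamma$. Let $f_1$ and $f_2$ be weight functions for $\Gamma_1$ and $\Gamma_2$, respectively, and let $f$ be the extension of $\{f_1,f_2\}$ to $\Gamma$, i.e. the unique weight function on $\Gamma$ whose restriction to $\Gamma_i$ is $f_i$ for $i=1,2$. Then the representation $R_f$ of $HK_\Gamma$ is effective if, and only if, the representations $R_{f_1}$ of $HK_{\Gamma_1}$ and $R_{f_2}$ of $HK_{\Gamma_2}$ are both effective.
   Context: "Union" means $V(\Gamma)=V(\Gamma_1)\cup V(\Gamma_2)$ and $E(\Gamma)=E(\Gamma_1)\cup E(\Gamma_2)$; a full subgraph contains all edges of $\Gamma$ between its vertices. A source is a vertex with no incoming edges, a sink is a vertex with no outgoing edges. For a finite directed graph $\Gamma$ without loops and with at most one directed edge between any pair of vertices, the Hecke-Kiselman monoid $HK_\Gamma$ is the quotient of the free monoid $V(\Gamma)^*$ on the vertex set by the relations: $x^2=x$ for all $x\in V(\Gamma)$; $xy=yx$ if there is no edge between $x$ and $y$; $xyx=yxy=xy$ if there is an edge $x\to y$. Let $W=\bigoplus_{v\in V(\Gamma)}\mathcal{R}v$. A weight function is a function $f:E(\Gamma)\to\mathcal{R}\setminus\{0\}$; write $f_{xy}$ for the weight of $x\to y$. For $x\in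 V(\Gamma)$ let $\theta_x^f\in \mathrm{End}_{\mathcal{R}}(W)$ be the linear map with $\theta_x^f(y)=y$ for vertices $y\neq x$ and $\theta_x^f(x)=\sum_{z\to x}f_{zx}z$ (an empty sum is $0$). The assignment $x\mapsto\theta_x^f$ extends to a monoid homomorphism $R_f:HK_\Gamma\to \mathrm{End}_{\mathcal{R}}(W)$ (product being composition). A representation is effective if it is injective as a map on the monoid. *)

theory Defs
  imports "Graph_Theory.Graph_Theory" "HOL-Algebra.Group"
begin

section \<open>Directed graphs\<close>

text \<open>Arcs are pairs, so there are no parallel arcs; \<open>asym_arcs\<close> also excludes 2-cycles.\<close>

locale oriented_digraph = pair_digraph +
  assumes asym_arcs: "(x, y) \<in> parcs G \<Longrightarrow> (y, x) \<notin> parcs G"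

definition is_source :: "'v pair_pre_digraph \<Rightarrow> 'v \<Rightarrow> bool" where
  "is_source G a \<longleftrightarrow> a \<in> pverts G \<and> in_arcs (with_proj G) a = {}"

definition is_sink :: "'v pair_pre_digraph \<Rightarrow> 'v \<Rightarrow> bool" where
  "is_sink G a \<longleftrightarrow> a \<in> pverts G \<and> out_arcs (with_proj G) a = {}"

section \<open>The Hecke-Kiselman monoid\<close>

text \<open>The least congruence on the free monoid \<open>lists (pverts G)\<close> containing the
  defining relations.\<close>

inductive hk_eq :: "'v pair_pre_digraph \<Rightarrow> 'v list \<Rightarrow> 'v list \<Rightarrow> bool"
  for G :: "'v pair_pre_digraph" where
  hk_refl: "u \<in> lists (pverts G) \<Longrightarrow> hk_eq G u u"
| hk_sym: "hk_eq G u v \<Longrightarrow> hk_eq G v u"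
| hk_trans: "hk_eq G u v \<Longrightarrow> hk_eq G v w \<Longrightarrow> hk_eq G u w"
| hk_context: "hk_eq G u v \<Longrightarrow> p \<in> lists (pverts G) \<Longrightarrow> q \<in> lists (pverts G) \<Longrightarrow>
    hk_eq G (p @ u @ q) (p @ v @ q)"
| hk_idem: "x \<in> pverts G \<Longrightarrow> hk_eq G [x, x] [x]"
| hk_comm: "x \<in> pverts G \<Longrightarrow> y \<in> pverts G \<Longrightarrow> (x, y) \<notin> parcs G \<Longrightarrow> (y, x) \<notin> parcs G \<Longrightarrow>
    hk_eq G [x, y] [y, x]"
| hk_arc1: "x \<in> pverts G \<Longrightarrow> y \<in> pverts G \<Longrightarrow> (x, y) \<in> parcs G \<Longrightarrow> hk_eq G [x, y, x] [x, y]"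
| hk_arc2: "x \<in> pverts G \<Longrightarrow> y \<in> pverts G \<Longrightarrow> (x, y) \<in> parcs G \<Longrightarrow> hk_eq G [y, x, y] [x, y]"

definition hk_class :: "'v pair_pre_digraph \<Rightarrow> 'v list \<Rightarrow> 'v list set" where
  "hk_class G w = {(u, v). hk_eq G u v} `` {w}"

definition HK :: "'v pair_pre_digraph \<Rightarrow> 'v list set monoid" where
  "HK G = \<lparr>carrier = lists (pverts G) // {(u, v). hk_eq G u v},
           mult = (\<lambda>A B. \<Union>u\<in>A. \<Union>v\<in>B. hk_class G (u @ v)),
           one = hk_class G []\<rparr>"

section \<open>The free module on the vertices and its endomorphism monoid\<close>

text \<open>A formal combination of vertices is its coefficient function, extended by 0 outside \<open>V\<close>.
  Endomorphisms are extensional functions on this carrier, so that their equality is equality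
  of maps on the module.\<close>

definition free_mod :: "'v set \<Rightarrow> ('v \<Rightarrow> 'r::comm_ring_1) set" where
  "free_mod V = {w. finite {v. w v \<noteq> 0} \<and> {v. w v \<noteq> 0} \<subseteq> V}"

definition basis_vec :: "'v \<Rightarrow> 'v \<Rightarrow> 'r::comm_ring_1" where
  "basis_vec v = (\<lambda>u. if u = v then 1 else 0)"

definition End_mod :: "'v set \<Rightarrow> (('v \<Rightarrow> 'r::comm_ring_1) \<Rightarrow> ('v \<Rightarrow> 'r)) monoid" where
  "End_mod V =
    \<lparr>carrier = {\<phi> \<in> free_mod V \<rightarrow>\<^sub>E free_mod V.
       (\<forall>w\<in>free_mod V. \<forall>w'\<in>free_mod V. \<phi> (\<lambda>v. w v + w' v) = (\<lambda>v. \<phi> w v + \<phi> w' v)) \<and>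
       (\<forall>c. \<forall>w\<in>free_mod V. \<phi> (\<lambda>v. c * w v) = (\<lambda>v. c * \<phi> w v))},
     mult = compose (free_mod V),
     one = (\<lambda>w\<in>free_mod V. w)\<rparr>"

section \<open>The representation attached to a weight function\<close>

definition weight_fun :: "'v pair_pre_digraph \<Rightarrow> ('v \<times> 'v \<Rightarrow> 'r::comm_ring_1) set" where
  "weight_fun G = parcs G \<rightarrow>\<^sub>E (UNIV - {0})"

definition theta_basis ::
  "'v pair_pre_digraph \<Rightarrow> ('v \<times> 'v \<Rightarrow> 'r::comm_ring_1) \<Rightarrow> 'v \<Rightarrow> 'v \<Rightarrow> ('v \<Rightarrow> 'r)" where
  "theta_basis G f x y =
    (if y = x then (\<lambda>u. \<Sum>z | (z, x) \<in> parcs G. f (z, x) * basis_vec z u) else basis_vec y)"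

definition theta ::
  "'v pair_pre_digraph \<Rightarrow> ('v \<times> 'v \<Rightarrow> 'r::comm_ring_1) \<Rightarrow> 'v \<Rightarrow> ('v \<Rightarrow> 'r) \<Rightarrow> ('v \<Rightarrow> 'r)" where
  "theta G f x =
    (\<lambda>w\<in>free_mod (pverts G). (\<lambda>u. \<Sum>y\<in>pverts G. w y * theta_basis G f x y u))"

definition word_rep ::
  "'v pair_pre_digraph \<Rightarrow> ('v \<times> 'v \<Rightarrow> 'r::comm_ring_1) \<Rightarrow> 'v list \<Rightarrow> ('v \<Rightarrow> 'r) \<Rightarrow> ('v \<Rightarrow> 'r)" where
  "word_rep G f w = foldr (\<lambda>x \<phi>. theta G f x \<otimes>\<^bsub>End_mod (pverts G)\<^esub> \<phi>) w \<one>\<^bsub>End_mod (pverts G)\<^esub>"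

text \<open>\<open>word_rep\<close> is constant on congruence classes, see \<open>word_rep_cong\<close> and \<open>HK_rep_class\<close> below.\<close>

definition HK_rep ::
  "'v pair_pre_digraph \<Rightarrow> ('v \<times> 'v \<Rightarrow> 'r::comm_ring_1) \<Rightarrow> 'v list set \<Rightarrow> ('v \<Rightarrow> 'r) \<Rightarrow> ('v \<Rightarrow> 'r)" where
  "HK_rep G f C = the_elem (word_rep G f ` C)"

definition effective :: "'v pair_pre_digraph \<Rightarrow> ('v \<times> 'v \<Rightarrow> 'r::comm_ring_1) \<Rightarrow> bool" where
  "effective G f \<longleftrightarrow> inj_on (HK_rep G f) (carrier (HK G))"

section \<open>Well-definedness\<close>

lemma hk_eq_in_lists: "hk_eq G u v \<Longrightarrow> u \<in> lists (pverts G) \<and> v \<in> lists (pverts G)"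
  by (induction rule: hk_eq.induct) auto

lemma hk_equiv: "equiv (lists (pverts G)) {(u, v). hk_eq G u v}"
proof (rule equivI)
  show "refl_on (lists (pverts G)) {(u, v). hk_eq G u v}"
    by (auto simp: refl_on_def intro: hk_refl)
  show "sym {(u, v). hk_eq G u v}" by (auto simp: sym_def intro: hk_sym)
  show "trans {(u, v). hk_eq G u v}" by (auto simp: trans_def intro: hk_trans)
  show "{(u, v). hk_eq G u v} \<subseteq> lists (pverts G) \<times> lists (pverts G)"
    using hk_eq_in_lists by blast
qed

lemma hk_class_eq_iff:
  "u \<in> lists (pverts G) \<Longrightarrow> v \<in> lists (pverts G) \<Longrightarrow> hk_class G u = hk_class G v \<longleftrightarrow> hk_eq G u v"
  unfolding hk_class_def using eq_equiv_class_iff[OF hk_equiv[of G], of u v] by simp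

lemma hk_class_in_HK: "u \<in> lists (pverts G) \<Longrightarrow> hk_class G u \<in> carrier (HK G)"
  unfolding HK_def hk_class_def by (simp only: monoid.simps partial_object.simps) (rule quotientI)

lemma HK_E:
  assumes "C \<in> carrier (HK G)"
  obtains u where "u \<in> lists (pverts G)" "C = hk_class G u"
  using assms by (auto simp: HK_def hk_class_def elim!: quotientE)

lemma hk_append: "hk_eq G u u' \<Longrightarrow> hk_eq G v v' \<Longrightarrow> hk_eq G (u @ v) (u' @ v')"
  by (metis append_Nil append_Nil2 hk_context hk_eq_in_lists hk_trans lists.Nil)

lemma HK_mult_class:
  assumes "u \<in> lists (pverts G)" "v \<in> lists (pverts G)"
  shows "hk_class G u \<otimes>\<^bsub>HK G\<^esub> hk_class G v = hk_class G (u @ v)"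
proof -
  have "hk_class G (u' @ v') = hk_class G (u @ v)"
    if "u' \<in> hk_class G u" "v' \<in> hk_class G v" for u' v'
  proof -
    have "hk_eq G (u @ v) (u' @ v')" using that by (auto simp: hk_class_def intro: hk_append)
    then show ?thesis by (metis hk_class_eq_iff hk_eq_in_lists)
  qed
  moreover have "u \<in> hk_class G u" "v \<in> hk_class G v"
    using assms by (auto simp: hk_class_def intro: hk_refl)
  ultimately have "(\<Union>u'\<in>hk_class G u. \<Union>v'\<in>hk_class G v. hk_class G (u' @ v')) = hk_class G (u @ v)"
    by blast
  then show ?thesis by (simp add: HK_def)
qed

lemma HK_monoid: "monoid (HK G)"
proof (rule monoidI)
  have one: "\<one>\<^bsub>HK G\<^esub> = hk_class G []" by (simp add: HK_def)
  show "\<one>\<^bsub>HK G\<^esub> \<in> carrier (HK G)" by (simp add: one hk_class_in_HK)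
  fix x y z assume "x \<in> carrier (HK G)" "y \<in> carrier (HK G)" "z \<in> carrier (HK G)"
  then obtain u v w where
    "u \<in> lists (pverts G)" "v \<in> lists (pverts G)" "w \<in> lists (pverts G)"
    "x = hk_class G u" "y = hk_class G v" "z = hk_class G w"
    by (elim HK_E) blast
  then show "x \<otimes>\<^bsub>HK G\<^esub> y \<otimes>\<^bsub>HK G\<^esub> z = x \<otimes>\<^bsub>HK G\<^esub> (y \<otimes>\<^bsub>HK G\<^esub> z)"
    by (simp add: HK_mult_class)
next
  have one: "\<one>\<^bsub>HK G\<^esub> = hk_class G []" by (simp add: HK_def)
  fix x assume "x \<in> carrier (HK G)"
  then obtain u where "u \<in> lists (pverts G)" "x = hk_class G u" by (elim HK_E) blast
  then show "\<one>\<^bsub>HK G\<^esub> \<otimes>\<^bsub>HK G\<^esub> x = x" "x \<otimes>\<^bsub>HK G\<^esub> \<one>\<^bsub>HK G\<^esub> = x"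
    by (simp_all add: HK_mult_class one)
next
  fix x y assume "x \<in> carrier (HK G)" "y \<in> carrier (HK G)"
  then obtain u v where "u \<in> lists (pverts G)" "v \<in> lists (pverts G)"
    "x = hk_class G u" "y = hk_class G v"
    by (elim HK_E) blast
  then show "x \<otimes>\<^bsub>HK G\<^esub> y \<in> carrier (HK G)" by (simp add: HK_mult_class hk_class_in_HK)
qed

lemma free_mod_finite: "finite V \<Longrightarrow> free_mod V = {w. \<forall>v. v \<notin> V \<longrightarrow> w v = 0}"
  by (auto simp: free_mod_def intro: finite_subset)

lemma End_mod_monoid:
  assumes "finite (V :: 'v set)"
  shows "monoid (End_mod V :: (('v \<Rightarrow> 'r::comm_ring_1) \<Rightarrow> ('v \<Rightarrow> 'r)) monoid)"
proof (rule monoidI)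
  let ?E = "End_mod V :: (('v \<Rightarrow> 'r) \<Rightarrow> ('v \<Rightarrow> 'r)) monoid"
  note fm = free_mod_finite[OF assms]
  show "\<one>\<^bsub>?E\<^esub> \<in> carrier ?E"
    by (auto simp: End_mod_def fm)
  fix x y z assume x: "x \<in> carrier ?E" and y: "y \<in> carrier ?E" 
  have yW: "y w \<in> free_mod V" if "w \<in> free_mod V" for w
    using y that by (auto simp: End_mod_def)
  have xW: "x w \<in> free_mod V" if "w \<in> free_mod V" for w
    using x that by (auto simp: End_mod_def)
  have add: "(\<lambda>v. w v + w' v) \<in> free_mod V" if "w \<in> free_mod V" "w' \<in> free_mod V" for w w' :: "'v \<Rightarrow> 'r"
    using that by (auto simp: fm)
  have scl: "(\<lambda>v. c * w v) \<in> free_mod V" if "w \<in> free_mod V" for c and w :: "'v \<Rightarrow> 'r"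
    using that by (auto simp: fm)
  show "x \<otimes>\<^bsub>?E\<^esub> y \<in> carrier ?E"
    using x y xW yW add scl by (auto simp: End_mod_def compose_def)
  show "\<one>\<^bsub>?E\<^esub> \<otimes>\<^bsub>?E\<^esub> x = x" "x \<otimes>\<^bsub>?E\<^esub> \<one>\<^bsub>?E\<^esub> = x"
    using x by (auto simp: End_mod_def compose_def fun_eq_iff PiE_def extensional_def Pi_def)
  assume z: "z \<in> carrier ?E"
  show "x \<otimes>\<^bsub>?E\<^esub> y \<otimes>\<^bsub>?E\<^esub> z = x \<otimes>\<^bsub>?E\<^esub> (y \<otimes>\<^bsub>?E\<^esub> z)"
    using z by (auto simp: End_mod_def compose_def fun_eq_iff PiE_def Pi_def)
qed

context oriented_digraph begin

lemma finite_in_nbrs: "finite {z. (z, x) \<in> parcs G}"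
  by (rule finite_subset[OF _ pair_finite_verts]) (auto dest: in_arcsD1)

lemma fm: "free_mod (pverts G) = {w. \<forall>v. v \<notin> pverts G \<longrightarrow> w v = 0}"
  by (rule free_mod_finite[OF pair_finite_verts])

lemma arc_out: "v \<notin> pverts G \<Longrightarrow> (v, x) \<notin> parcs G" "v \<notin> pverts G \<Longrightarrow> (x, v) \<notin> parcs G"
  by (auto dest: in_arcsD1 in_arcsD2)

lemma sum_in_nbrs:
  "(\<Sum>z | (z, x) \<in> parcs G. f (z, x) * basis_vec z u) = (if (u, x) \<in> parcs G then f (u, x) else 0)"
proof -
  have "(\<Sum>z | (z, x) \<in> parcs G. f (z, x) * basis_vec z u)
      = (\<Sum>z | (z, x) \<in> parcs G. if u = z then f (z, x) else 0)"
    by (rule sum.cong) (auto simp: basis_vec_def)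
  also have "\<dots> = (if u \<in> {z. (z, x) \<in> parcs G} then f (u, x) else 0)"
    by (rule sum.delta'[OF finite_in_nbrs])
  finally show ?thesis by simp
qed

lemma theta_apply:
  assumes "w \<in> free_mod (pverts G)" "x \<in> pverts G"
  shows "theta G f x w u = (if u = x then 0 else w u) + (if (u, x) \<in> parcs G then w x * f (u, x) else 0)"
proof -
  have tx: "theta_basis G f x x u = (if (u, x) \<in> parcs G then f (u, x) else 0)"
    by (simp add: theta_basis_def sum_in_nbrs)
  have ty: "theta_basis G f x y u = (if u = y then 1 else 0)" if "y \<noteq> x" for y
    using that by (simp add: theta_basis_def basis_vec_def)
  have "theta G f x w u = (\<Sum>y\<in>pverts G. w y * theta_basis G f x y u)"
    using assms by (simp add: theta_def)
  also have "\<dots> = w x * theta_basis G f x x u + (\<Sum>y\<in>pverts G - {x}. w y * theta_basis G f x y u)"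
    by (rule sum.remove[OF pair_finite_verts assms(2)])
  also have "(\<Sum>y\<in>pverts G - {x}. w y * theta_basis G f x y u)
      = (\<Sum>y\<in>pverts G - {x}. if u = y then w y else 0)"
    by (rule sum.cong) (auto simp: ty)
  also have "\<dots> = (if u \<in> pverts G - {x} then w u else 0)"
    by (rule sum.delta') (simp add: pair_finite_verts)
  also have "\<dots> = (if u = x then 0 else w u)" using assms(1) by (auto simp: fm)
  finally show ?thesis by (simp add: tx)
qed

lemma theta_in_mod:
  assumes "w \<in> free_mod (pverts G)" "x \<in> pverts G"
  shows "theta G f x w \<in> free_mod (pverts G)"
  using assms by (auto simp: fm theta_apply[OF assms] arc_out)

lemma theta_End:
  assumes "x \<in> pverts G"
  shows "theta G f x \<in> carrier (End_mod (pverts G))"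
proof -
  have add: "(\<lambda>v. w v + w' v) \<in> free_mod (pverts G)" 
    if "w \<in> free_mod (pverts G)" "w' \<in> free_mod (pverts G)" for w w' :: "'a \<Rightarrow> 'r::comm_ring_1"
    using that by (auto simp: fm)
  have scl: "(\<lambda>v. c * w v) \<in> free_mod (pverts G)"
    if "w \<in> free_mod (pverts G)" for c and w :: "'a \<Rightarrow> 'r::comm_ring_1"
    using that by (auto simp: fm)
  have ext: "theta G f x \<in> extensional (free_mod (pverts G))" by (simp add: theta_def)
  show ?thesis
    using assms ext
    by (auto simp: End_mod_def PiE_def theta_in_mod fun_eq_iff theta_apply add scl algebra_simps)
qed

lemma theta_basis_vec:
  assumes "x \<in> pverts G"
  shows "y \<in> pverts G \<Longrightarrow> y \<noteq> x \<Longrightarrow> theta G f x (basis_vec y) = basis_vec y"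
    and "theta G f x (basis_vec x) = (\<lambda>u. \<Sum>z | (z, x) \<in> parcs G. f (z, x) * basis_vec z u)"
proof -
  have b: "(basis_vec y :: 'a \<Rightarrow> 'b) \<in> free_mod (pverts G)" if "y \<in> pverts G" for y
    using that by (auto simp: fm basis_vec_def)
  show "theta G f x (basis_vec y) = basis_vec y" if "y \<in> pverts G" "y \<noteq> x"
    using that unfolding fun_eq_iff theta_apply[OF b[OF that(1)] assms] by (auto simp: basis_vec_def)
  show "theta G f x (basis_vec x) = (\<lambda>u. \<Sum>z | (z, x) \<in> parcs G. f (z, x) * basis_vec z u)"
  proof
    fix u
    show "theta G f x (basis_vec x) u = (\<Sum>z | (z, x) \<in> parcs G. f (z, x) * basis_vec z u)"
      by (simp add: theta_apply[OF b[OF assms] assms] sum_in_nbrs) (simp add: basis_vec_def)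
  qed
qed

lemma word_rep_End:
  "w \<in> lists (pverts G) \<Longrightarrow> word_rep G f w \<in> carrier (End_mod (pverts G))"
proof (induction w)
  case Nil
  then show ?case
    by (simp add: word_rep_def monoid.one_closed[OF End_mod_monoid[OF pair_finite_verts]])
next
  case (Cons x w)
  then show ?case
    by (auto simp: word_rep_def theta_End intro!: monoid.m_closed[OF End_mod_monoid[OF pair_finite_verts]])
qed

lemma word_rep_append:
  assumes "v \<in> lists (pverts G)"
  shows "u \<in> lists (pverts G) \<Longrightarrow>
    word_rep G f (u @ v) = word_rep G f u \<otimes>\<^bsub>End_mod (pverts G)\<^esub> word_rep G f v"
proof (induction u)
  case Nil
  then show ?case
    using monoid.l_one[OF End_mod_monoid[OF pair_finite_verts] word_rep_End[OF assms, of f]]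
    by (simp add: word_rep_def)
next
  case (Cons x u)
  have c: "word_rep G f (x # w) = theta G f x \<otimes>\<^bsub>End_mod (pverts G)\<^esub> word_rep G f w" for w
    by (simp add: word_rep_def)
  show ?case using Cons assms
    by (simp add: c theta_End word_rep_End monoid.m_assoc[OF End_mod_monoid[OF pair_finite_verts]])
qed

lemma word_rep_simps:
  "w \<in> free_mod (pverts G) \<Longrightarrow> word_rep G f [] w = w"
  "w \<in> free_mod (pverts G) \<Longrightarrow> word_rep G f (x # u) w = theta G f x (word_rep G f u w)"
  by (simp_all add: word_rep_def End_mod_def compose_def)

lemma word_rep_eqI:
  assumes "u \<in> lists (pverts G)" "v \<in> lists (pverts G)"
    and "\<And>w. w \<in> free_mod (pverts G) \<Longrightarrow> word_rep G f u w = word_rep G f v w"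
  shows "word_rep G f u = word_rep G f v"
  using assms word_rep_End[OF assms(1), of f] word_rep_End[OF assms(2), of f]
  by (auto simp: End_mod_def intro: PiE_ext)

lemma word_rep_cong: "hk_eq G u v \<Longrightarrow> word_rep G f u = word_rep G f v"
proof (induction rule: hk_eq.induct)
  case (hk_context u v p q)
  then show ?case using hk_eq_in_lists[of G u v] by (simp add: word_rep_append)
next
  case (hk_idem x)
  moreover have "(x, x) \<notin> parcs G" using pair_no_loops by fastforce
  ultimately show ?case
    by (intro word_rep_eqI)
       (auto simp: word_rep_simps theta_apply theta_in_mod fun_eq_iff)
next
  case (hk_comm x y)
  then show ?case
    by (intro word_rep_eqI)
       (auto simp: word_rep_simps theta_apply theta_in_mod fun_eq_iff)
next
  case (hk_arc1 x y)
  moreover have "(y, x) \<notin> parcs G" "x \<noteq> y" "(x, x) \<notin> parcs G" "(y, y) \<notin> parcs G"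
    using asym_arcs hk_arc1(3) pair_no_loops by fastforce+
  ultimately show ?case
    by (intro word_rep_eqI)
       (auto simp: word_rep_simps theta_apply theta_in_mod fun_eq_iff algebra_simps)
next
  case (hk_arc2 x y)
  moreover have "(y, x) \<notin> parcs G" "x \<noteq> y" "(x, x) \<notin> parcs G" "(y, y) \<notin> parcs G"
    using asym_arcs hk_arc2(3) pair_no_loops by fastforce+
  ultimately show ?case
    by (intro word_rep_eqI)
       (auto simp: word_rep_simps theta_apply theta_in_mod fun_eq_iff algebra_simps)
qed auto

lemma HK_rep_class:
  assumes "w \<in> lists (pverts G)"
  shows "HK_rep G f (hk_class G w) = word_rep G f w"
proof -
  have "w \<in> hk_class G w" using assms by (auto simp: hk_class_def intro: hk_refl)
  moreover have "word_rep G f u = word_rep G f w" if "u \<in> hk_class G w" for u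
    using that word_rep_cong[of w u f] by (simp add: hk_class_def)
  ultimately have "word_rep G f ` hk_class G w = {word_rep G f w}" by blast
  then show ?thesis by (simp add: HK_rep_def)
qed

lemma HK_rep_hom:
  "HK_rep G f \<in> hom (HK G) (End_mod (pverts G))"
  "HK_rep G f \<one>\<^bsub>HK G\<^esub> = \<one>\<^bsub>End_mod (pverts G)\<^esub>"
proof -
  show "HK_rep G f \<in> hom (HK G) (End_mod (pverts G))"
  proof (rule homI)
    fix A B assume "A \<in> carrier (HK G)" "B \<in> carrier (HK G)"
    then obtain u v where uv: "u \<in> lists (pverts G)" "v \<in> lists (pverts G)"
      "A = hk_class G u" "B = hk_class G v"
      by (elim HK_E) blast
    have "u @ v \<in> lists (pverts G)" using uv by simp
    then show "HK_rep G f (A \<otimes>\<^bsub>HK G\<^esub> B) = HK_rep G f A \<otimes>\<^bsub>End_mod (pverts G)\<^esub> HK_rep G f B"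
      using HK_rep_class[of "u @ v" f] HK_rep_class[of u f] HK_rep_class[of v f] uv
      by (simp only: HK_mult_class word_rep_append)
  next
    fix A assume "A \<in> carrier (HK G)"
    then obtain u where "u \<in> lists (pverts G)" "A = hk_class G u" by (elim HK_E) blast
    then show "HK_rep G f A \<in> carrier (End_mod (pverts G))"
      by (metis HK_rep_class word_rep_End)
  qed
  have "\<one>\<^bsub>HK G\<^esub> = hk_class G []" by (simp add: HK_def)
  then show "HK_rep G f \<one>\<^bsub>HK G\<^esub> = \<one>\<^bsub>End_mod (pverts G)\<^esub>"
    by (simp add: HK_rep_class) (simp add: word_rep_def)
qed

lemma HK_rep_generator:
  assumes "x \<in> pverts G"
  shows "HK_rep G f (hk_class G [x]) = theta G f x"
  using assms monoid.r_one[OF End_mod_monoid[OF pair_finite_verts] theta_End[OF assms]]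
  by (simp add: HK_rep_class) (simp add: word_rep_def)

end

end

theory Submission
  imports Defs
begin

text \<open>Since \<open>a\<close> is a source or a sink, all but one of its occurrences in a word can be deleted, so
  every element of the monoid is represented by a word in which \<open>a\<close> occurs at most once, and the
  other letters of the two parts commute. Hence the monoid of \<open>G\<close> embeds in the product of those
  of \<open>G1\<close> and \<open>G2\<close> by deleting letters. The image of \<open>w\<close> under the representation of \<open>G\<close> determines
  the image of its restriction to \<open>G1\<close> on a submodule (source) or on a quotient (sink). Conversely,
  for words over \<open>G1\<close> the image for \<open>G1\<close> determines the image for \<open>G\<close>: the remaining coordinates
  depend only on whether \<open>a\<close> occurs, which is visible in the \<open>a\<close>-coordinate.\<close>

section \<open>Words in Hecke-Kiselman monoids\<close>

declare hk_trans [trans]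

text \<open>The equation between the middle words is a separate premise, so that simplification can
  match two bracketings of one concatenation.\<close>

lemma hk_trans_eq: "hk_eq G u v \<Longrightarrow> hk_eq G v' w \<Longrightarrow> v = v' \<Longrightarrow> hk_eq G u w"
  by (simp add: hk_trans[of G u v w])

lemma hk_comm_letter_word:
  assumes "x \<in> pverts G" "q \<in> lists (pverts G)"
    and "\<And>y. y \<in> set q \<Longrightarrow> (x, y) \<notin> parcs G \<and> (y, x) \<notin> parcs G"
  shows "hk_eq G (x # q) (q @ [x])"
  using assms(2,3)
proof (induction q rule: list.induct)
  case Nil
  then show ?case using assms(1) by (auto intro: hk_refl)
next
  case (Cons y q)
  then have 1: "hk_eq G ([x, y] @ q) ([y, x] @ q)"
    using assms(1) by (intro hk_append hk_comm hk_refl) auto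
  have 2: "hk_eq G ([y] @ (x # q)) ([y] @ (q @ [x]))"
    using Cons by (intro hk_append hk_refl) auto
  show ?case using hk_trans_eq[OF 1 2] by simp
qed

lemma hk_comm_words:
  assumes "p \<in> lists (pverts G)" "q \<in> lists (pverts G)"
    and "\<And>x y. x \<in> set p \<Longrightarrow> y \<in> set q \<Longrightarrow> (x, y) \<notin> parcs G \<and> (y, x) \<notin> parcs G"
  shows "hk_eq G (p @ q) (q @ p)"
  using assms(1,3)
proof (induction p rule: list.induct)
  case Nil
  then show ?case using assms(2) by (auto intro: hk_refl)
next
  case (Cons x p)
  then have 1: "hk_eq G ([x] @ (p @ q)) ([x] @ (q @ p))"
    by (intro hk_append[of _ "[x]"] hk_refl) auto
  have 2: "hk_eq G ((x # q) @ p) ((q @ [x]) @ p)"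
    using Cons assms(2) by (intro hk_append[of _ _ _ p] hk_comm_letter_word hk_refl) auto
  show ?case using hk_trans_eq[OF 1 2] by simp
qed

text \<open>Both sides of every defining relation use the same letters. This carries the occurrence
  of \<open>a\<close> from a word to any equivalent one.\<close>

lemma hk_eq_set: "hk_eq G u v \<Longrightarrow> set u = set v"
  by (induction rule: hk_eq.induct) auto

text \<open>For a sink, \<open>a y a = y a\<close> holds for every letter \<open>y\<close>: by an
  arc relation if \<open>y -> a\<close>, and otherwise by commutation and idempotence. The last
  \<open>a\<close> survives.\<close>

lemma hk_sink_absorb:
  assumes "a \<in> pverts G" "\<And>y. (a, y) \<notin> parcs G" "u \<in> lists (pverts G)"
  shows "hk_eq G (a # u @ [a]) (u @ [a])"
  using assms(3)
proof (induction u rule: rev_induct)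
  case Nil
  then show ?case using assms(1) by (auto intro: hk_idem)
next
  case (snoc y u)
  have u: "u \<in> lists (pverts G)" and y: "y \<in> pverts G" using snoc.prems by auto
  have aya: "hk_eq G [a, y, a] [y, a]"
  proof (cases "(y, a) \<in> parcs G")
    case True
    then show ?thesis using assms(1) y by (intro hk_arc2) auto
  next
    case False
    then have 1: "hk_eq G ([a, y] @ [a]) ([y, a] @ [a])"
      using assms(1,2) y by (intro hk_append hk_comm hk_refl) auto
    have 2: "hk_eq G ([y] @ [a, a]) ([y] @ [a])"
      using assms(1) y by (intro hk_append hk_idem hk_refl) auto
    show ?thesis using hk_trans_eq[OF 1 2] by simp
  qed
  \<comment> \<open>The chain is \<open>a u y a = a u a y a = u a y a = u y a\<close>; the auxiliary
    \<open>a\<close> makes the induction hypothesis applicable to \<open>a u a\<close>.\<close>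
  have 1: "hk_eq G ((a # u) @ [y, a]) ((a # u) @ [a, y, a])"
    using u y assms(1) by (intro hk_append[OF _ hk_sym[OF aya]] hk_refl) auto
  have 2: "hk_eq G ((a # u @ [a]) @ [y, a]) ((u @ [a]) @ [y, a])"
    using snoc.IH u y assms(1) by (intro hk_append[of _ _ _ "[y, a]"] hk_refl) auto
  have 3: "hk_eq G (u @ [a, y, a]) (u @ [y, a])"
    using u by (intro hk_append[OF _ aya] hk_refl) auto
  show ?case using hk_trans_eq[OF hk_trans_eq[OF 1 2] 3] by simp
qed

text \<open>Dual to the sink case: now \<open>a y a = a y\<close> for every letter \<open>y\<close>,
  and the first \<open>a\<close> survives.\<close>

lemma hk_source_absorb:
  assumes "a \<in> pverts G" "\<And>y. (y, a) \<notin> parcs G" "u \<in> lists (pverts G)"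
  shows "hk_eq G (a # u @ [a]) (a # u)"
  using assms(3)
proof (induction u rule: list.induct)
  case Nil
  then show ?case using assms(1) by (auto intro: hk_idem)
next
  case (Cons y u)
  have u: "u \<in> lists (pverts G)" and y: "y \<in> pverts G" using Cons.prems by auto
  have aya: "hk_eq G [a, y, a] [a, y]"
  proof (cases "(a, y) \<in> parcs G")
    case True
    then show ?thesis using assms(1) y by (intro hk_arc1) auto
  next
    case False
    then have 1: "hk_eq G ([a] @ [y, a]) ([a] @ [a, y])"
      using assms(1,2) y by (intro hk_append hk_comm hk_refl) auto
    have 2: "hk_eq G ([a, a] @ [y]) ([a] @ [y])"
      using assms(1) y by (intro hk_append hk_idem hk_refl) auto
    show ?thesis using hk_trans_eq[OF 1 2] by simp
  qed
  \<comment> \<open>The chain is \<open>a y u a = a y a u a = a y a u = a y u\<close>.\<close>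
  have 1: "hk_eq G ([a, y] @ (u @ [a])) ([a, y, a] @ (u @ [a]))"
    using u y assms(1) by (intro hk_append[OF hk_sym[OF aya]] hk_refl) auto
  have 2: "hk_eq G ([a, y] @ (a # u @ [a])) ([a, y] @ (a # u))"
    using Cons.IH u y assms(1) by (intro hk_append[of _ "[a, y]"] hk_refl) auto
  have 3: "hk_eq G ([a, y, a] @ u) ([a, y] @ u)"
    using u by (intro hk_append[OF aya] hk_refl) auto
  show ?case using hk_trans_eq[OF hk_trans_eq[OF 1 2] 3] by simp
qed

text \<open>The word is built by prepending letters: a new \<open>a\<close> is absorbed by the one
  further right, so the last occurrence is kept.\<close>

lemma hk_sink_normal_form:
  assumes "a \<in> pverts G" "\<And>y. (a, y) \<notin> parcs G" "w \<in> lists (pverts G)" "a \<in> set w"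
  shows "\<exists>u v. a \<notin> set u \<and> a \<notin> set v \<and> hk_eq G w (u @ a # v)"
  using assms(3,4)
proof (induction w rule: list.induct)
  case (Cons x w)
  then have w: "w \<in> lists (pverts G)" and x: "x \<in> pverts G" by auto
  show ?case
  proof (cases "a \<in> set w")
    case True
    then obtain u v where uv: "a \<notin> set u" "a \<notin> set v" "hk_eq G w (u @ a # v)"
      using Cons.IH w by auto
    then have u: "u \<in> lists (pverts G)" and v: "v \<in> lists (pverts G)"
      using hk_eq_in_lists[OF uv(3)] by auto
    have 1: "hk_eq G ([x] @ w) ([x] @ (u @ a # v))"
      using x by (intro hk_append uv(3) hk_refl) auto
    show ?thesis
    proof (cases "x = a")
      case True
      have 2: "hk_eq G ((a # u @ [a]) @ v) ((u @ [a]) @ v)"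
        using assms(1,2) u v by (intro hk_append[of _ _ _ v] hk_sink_absorb hk_refl) auto
      have "hk_eq G (x # w) (u @ a # v)" using hk_trans_eq[OF 1 2] True by simp
      then show ?thesis using uv(1,2) by blast
    next
      case False
      then have "a \<notin> set (x # u)" "hk_eq G (x # w) ((x # u) @ a # v)" using 1 uv(1) by auto
      then show ?thesis using uv(2) by blast
    qed
  next
    case False
    then have "x = a" using Cons.prems by auto
    then have "a \<notin> set []" "hk_eq G (x # w) ([] @ a # w)" using x w by (auto intro!: hk_refl)
    with False show ?thesis by blast
  qed
qed simp

text \<open>Here letters are appended, since the first occurrence is the one that absorbs the
  others.\<close>

lemma hk_source_normal_form:
  assumes "a \<in> pverts G" "\<And>y. (y, a) \<notin> parcs G" "w \<in> lists (pverts G)" "a \<in> set w"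
  shows "\<exists>u v. a \<notin> set u \<and> a \<notin> set v \<and> hk_eq G w (u @ a # v)"
  using assms(3,4)
proof (induction w rule: rev_induct)
  case (snoc x w)
  then have w: "w \<in> lists (pverts G)" and x: "x \<in> pverts G" by auto
  show ?case
  proof (cases "a \<in> set w")
    case True
    then obtain u v where uv: "a \<notin> set u" "a \<notin> set v" "hk_eq G w (u @ a # v)"
      using snoc.IH w by auto
    then have u: "u \<in> lists (pverts G)" and v: "v \<in> lists (pverts G)"
      using hk_eq_in_lists[OF uv(3)] by auto
    have 1: "hk_eq G (w @ [x]) ((u @ a # v) @ [x])"
      using x by (intro hk_append uv(3) hk_refl) auto
    show ?thesis
    proof (cases "x = a")
      case True
      have 2: "hk_eq G (u @ (a # v @ [a])) (u @ (a # v))"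
        using assms(1,2) u v by (intro hk_append[of _ u] hk_source_absorb hk_refl) auto
      have "hk_eq G (w @ [x]) (u @ a # v)" using hk_trans_eq[OF 1 2] True by simp
      then show ?thesis using uv(1,2) by blast
    next
      case False
      then have "a \<notin> set (v @ [x])" "hk_eq G (w @ [x]) (u @ a # (v @ [x]))" using 1 uv(2) by auto
      then show ?thesis using uv(1) by blast
    qed
  next
    case False
    then have "x = a" using snoc.prems by auto
    then have "a \<notin> set []" "hk_eq G (w @ [x]) (w @ a # [])" using x w by (auto intro!: hk_refl)
    with False show ?thesis by blast
  qed
qed simp

section \<open>Full subgraphs\<close>

locale full_subdigraph = oriented_digraph G for G :: "'v pair_pre_digraph" +
  fixes H :: "'v pair_pre_digraph"
  assumes sub_verts: "pverts H \<subseteq> pverts G"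
    and sub_arcs: "(x, y) \<in> parcs H \<longleftrightarrow> (x, y) \<in> parcs G \<and> x \<in> pverts H \<and> y \<in> pverts H"
begin

abbreviation letters_in :: "'v list \<Rightarrow> 'v list" where
  "letters_in \<equiv> filter (\<lambda>x. x \<in> pverts H)"

lemma letters_in_lists [simp]: "letters_in u \<in> lists (pverts H)"
  by auto

lemma oriented_sub: "oriented_digraph H"
proof
  show "finite (pverts H)" using sub_verts pair_finite_verts by (rule finite_subset)
  show "finite (parcs H)" by (rule finite_subset[OF _ pair_finite_arcs]) (auto simp: sub_arcs)
qed (use sub_arcs asym_arcs pair_no_loops in \<open>auto simp: split_paired_all\<close>)

text \<open>Fullness enters through commutation: vertices of \<open>H\<close> not joined in
  \<open>H\<close> are not joined in \<open>G\<close> either.\<close>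

lemma hk_eq_mono: "hk_eq H u v \<Longrightarrow> hk_eq G u v"
proof (induction rule: hk_eq.induct)
  case (hk_context u v p q)
  then show ?case using sub_verts by (intro hk_eq.hk_context) auto
qed (use sub_verts in \<open>auto simp: sub_arcs intro: hk_eq.intros\<close>)

text \<open>Deleting letters turns a defining relation of \<open>G\<close> into one of
  \<open>H\<close>, an idempotence or a trivial identity. Hence deletion induces a retraction of the
  monoid of \<open>G\<close> onto that of \<open>H\<close>.\<close>

lemma hk_eq_letters_in: "hk_eq G u v \<Longrightarrow> hk_eq H (letters_in u) (letters_in v)"
proof (induction rule: hk_eq.induct)
  case (hk_context u v p q)
  then show ?case by (auto intro!: hk_eq.hk_context)
next
  case (hk_trans u v w)
  then show ?case by (blast intro: hk_eq.hk_trans)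
qed (auto simp: sub_arcs intro: hk_eq.intros)

end

text \<open>Every monoid element is the class of a word, so injectivity can be tested on words and
  classes disappear from the rest of the proof.\<close>

lemma effective_iff:
  assumes "oriented_digraph G"
  shows "effective G f \<longleftrightarrow>
    (\<forall>u\<in>lists (pverts G). \<forall>v\<in>lists (pverts G). word_rep G f u = word_rep G f v \<longrightarrow> hk_eq G u v)"
proof -
  interpret oriented_digraph G by (rule assms)
  have "carrier (HK G) = hk_class G ` lists (pverts G)"
    by (auto intro: hk_class_in_HK elim: HK_E)
  then show ?thesis
    by (simp add: effective_def inj_on_def HK_rep_class hk_class_eq_iff)
qed

section \<open>Coordinates of images under the representation\<close>

lemma basis_vec_in_free_mod: "v \<in> V \<Longrightarrow> basis_vec v \<in> free_mod V"
  by (auto simp: free_mod_def basis_vec_def)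

context oriented_digraph
begin

lemma word_rep_in_free_mod:
  "u \<in> lists (pverts G) \<Longrightarrow> w \<in> free_mod (pverts G) \<Longrightarrow> word_rep G f u w \<in> free_mod (pverts G)"
  by (induction u) (auto simp: word_rep_simps intro: theta_in_mod)

text \<open>A coordinate receives contributions only along arcs leaving its vertex. A sink has none,
  so its coordinate is constant until the letter \<open>a\<close> sets it to 0.\<close>

lemma word_rep_sink_coord:
  assumes "\<And>y. (a, y) \<notin> parcs G" "w \<in> free_mod (pverts G)"
  shows "u \<in> lists (pverts G) \<Longrightarrow> word_rep G f u w a = (if a \<in> set u then 0 else w a)"
proof (induction u rule: list.induct)
  case Nil
  then show ?case by (simp add: word_rep_simps assms)
next
  case (Cons x u)
  then have "word_rep G f u w \<in> free_mod (pverts G)"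
    using assms by (intro word_rep_in_free_mod) auto
  then show ?case using Cons assms by (auto simp: word_rep_simps theta_apply)
qed

end

context full_subdigraph
begin

sublocale sub: oriented_digraph H by (rule oriented_sub)

definition proj :: "('v \<Rightarrow> 'r::comm_ring_1) \<Rightarrow> 'v \<Rightarrow> 'r" where
  "proj w = (\<lambda>v. if v \<in> pverts H then w v else 0)"

lemma proj_in_free_mod: "proj w \<in> free_mod (pverts H)"
  by (simp add: sub.fm proj_def)

lemma proj_id: "w \<in> free_mod (pverts H) \<Longrightarrow> proj w = w"
  by (auto simp: sub.fm proj_def)

lemma free_mod_mono: "w \<in> free_mod (pverts H) \<Longrightarrow> w \<in> free_mod (pverts G)"
  using sub_verts by (auto simp: fm sub.fm)

text \<open>A letter \<open>x\<close> of \<open>H\<close> changes a coordinate \<open>z\<close> in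
  \<open>H\<close> only through \<open>w x\<close> and the arc \<open>z -> x\<close>, which lies in
  \<open>H\<close> by fullness. The weights are compared only on arcs of \<open>H\<close>, as a
  weight function is undefined elsewhere.\<close>

lemma proj_theta:
  assumes "x \<in> pverts H" "w \<in> free_mod (pverts G)"
    and agree: "\<And>e. e \<in> parcs H \<Longrightarrow> g e = f e"
  shows "proj (theta G f x w) = theta H g x (proj w)"
proof
  fix z
  have "x \<in> pverts G" using assms(1) sub_verts by auto
  then show "proj (theta G f x w) z = theta H g x (proj w) z"
    using theta_apply[OF assms(2), of x f z] sub.theta_apply[OF proj_in_free_mod assms(1), of g w z]
      assms(1) agree[of "(z, x)"]
    unfolding proj_def[of "theta G f x w"] by (auto simp: sub_arcs proj_def[of w, THEN fun_cong])
qed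

lemma proj_word_rep:
  assumes "w \<in> free_mod (pverts G)" and agree: "\<And>e. e \<in> parcs H \<Longrightarrow> g e = f e"
  shows "u \<in> lists (pverts H) \<Longrightarrow>
    proj (word_rep G f u w) = word_rep H g u (proj w)"
proof (induction u rule: list.induct)
  case Nil
  then show ?case by (simp add: word_rep_simps assms sub.word_rep_simps proj_in_free_mod)
next
  case (Cons x u)
  then have "word_rep G f u w \<in> free_mod (pverts G)"
    using sub_verts assms by (intro word_rep_in_free_mod) auto
  then show ?case using Cons
    by (simp add: word_rep_simps assms sub.word_rep_simps proj_in_free_mod proj_theta[OF _ _ agree])
qed

end

section \<open>Amalgamation along a source or a sink\<close>

locale hk_amalgam = oriented_digraph G + s1: full_subdigraph G H + s2: full_subdigraph G K
  for G H K :: "'v pair_pre_digraph" +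
  fixes a :: 'v
  assumes verts_union: "pverts G = pverts H \<union> pverts K"
    and arcs_union: "parcs G = parcs H \<union> parcs K"
    and verts_inter: "pverts H \<inter> pverts K = {a}"
    and source_or_sink: "(\<forall>y. (y, a) \<notin> parcs G) \<or> (\<forall>y. (a, y) \<notin> parcs G)"
begin

text \<open>All assumptions are symmetric in \<open>H\<close> and \<open>K\<close>, so each result
  about one part also serves the other.\<close>

lemma swap: "hk_amalgam G K H a"
  using verts_union arcs_union verts_inter source_or_sink by unfold_locales auto

lemma a_in: "a \<in> pverts G" "a \<in> pverts H" "a \<in> pverts K"
  using verts_inter verts_union by auto

text \<open>An arc of \<open>G\<close> belongs to one part together with both of its ends, while
  \<open>x\<close> and \<open>y\<close> share no part.\<close>

lemma no_arc:
  assumes "x \<in> pverts H" "x \<noteq> a" "y \<in> pverts K" "y \<noteq> a"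
  shows "(x, y) \<notin> parcs G" "(y, x) \<notin> parcs G"
proof -
  have "x \<notin> pverts K" "y \<notin> pverts H" using assms verts_inter by blast+
  then have "(x, y) \<notin> parcs H \<union> parcs K" "(y, x) \<notin> parcs H \<union> parcs K"
    by (simp_all add: s1.sub_arcs s2.sub_arcs)
  then show "(x, y) \<notin> parcs G" "(y, x) \<notin> parcs G"
    using arcs_union by blast+
qed

lemma inter_eq:
  "x \<in> pverts H \<Longrightarrow> x \<in> pverts K \<Longrightarrow> x = a"
  using verts_inter by blast

section \<open>Decomposition of words along \<open>a\<close>\<close>

lemma hk_commute_parts:
  assumes "p \<in> lists (pverts H)" "a \<notin> set p" "q \<in> lists (pverts K)" "a \<notin> set q"
  shows "hk_eq G (p @ q) (q @ p)"
proof (rule hk_comm_words)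
  show "p \<in> lists (pverts G)" "q \<in> lists (pverts G)"
    using assms verts_union by auto
  show "(x, y) \<notin> parcs G \<and> (y, x) \<notin> parcs G" if "x \<in> set p" "y \<in> set q" for x y
    using that assms no_arc[of x y] by auto
qed

text \<open>Away from \<open>a\<close> each letter lies in exactly one part, and letters of
  \<open>K\<close> can be moved to the right past those of \<open>H\<close>.\<close>

lemma hk_split:
  assumes "u \<in> lists (pverts G)" "a \<notin> set u"
  shows "hk_eq G u (s1.letters_in u @ s2.letters_in u)"
  using assms
proof (induction u rule: list.induct)
  case Nil
  then show ?case by (auto intro: hk_refl)
next
  case (Cons x u)
  then have IH: "hk_eq G u (s1.letters_in u @ s2.letters_in u)"
    and x: "x \<in> pverts G" "x \<noteq> a" and u: "u \<in> lists (pverts G)" and a: "a \<notin> set u" by auto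
  have 1: "hk_eq G ([x] @ u) ([x] @ (s1.letters_in u @ s2.letters_in u))"
    using x by (intro hk_append[OF _ IH] hk_refl) auto
  show ?case
  proof (cases "x \<in> pverts H")
    case True
    then show ?thesis using 1 x inter_eq[of x] by auto
  next
    case False
    then have K: "x \<in> pverts K" using x verts_union by auto
    have "hk_eq G ([x] @ s1.letters_in u) (s1.letters_in u @ [x])"
      using x K a by (intro hk_sym[OF hk_commute_parts]) auto
    then have 2: "hk_eq G (([x] @ s1.letters_in u) @ s2.letters_in u)
        ((s1.letters_in u @ [x]) @ s2.letters_in u)"
      using u by (intro hk_append[of _ _ _ "s2.letters_in u"] hk_refl) auto
    show ?thesis using hk_trans_eq[OF 1 2] False K by simp
  qed
qed

lemma hk_normal_form:
  assumes "w \<in> lists (pverts G)" "a \<in> set w"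
  obtains u v where "a \<notin> set u" "a \<notin> set v" "hk_eq G w (u @ a # v)"
  using assms source_or_sink hk_source_normal_form[of a G w] hk_sink_normal_form[of a G w] a_in
  by blast

text \<open>Only the outer products on either side of the single \<open>a\<close> are commuted. This
  changes which part is the contiguous inner block around \<open>a\<close>.\<close>

lemma hk_exchange:
  assumes "p \<in> lists (pverts H)" "a \<notin> set p" "p' \<in> lists (pverts H)" "a \<notin> set p'"
    and "q \<in> lists (pverts K)" "a \<notin> set q" "q' \<in> lists (pverts K)" "a \<notin> set q'"
  shows "hk_eq G (q @ (p @ a # p') @ q') (p @ (q @ a # q') @ p')"
proof -
  have "hk_eq G (q @ p) (p @ q)" "hk_eq G (p' @ q') (q' @ p')"
    using hk_sym[OF hk_commute_parts[of p q]] hk_commute_parts[of p' q'] assms by simp_all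
  moreover have "hk_eq G [a] [a]" using a_in by (auto intro!: hk_refl)
  ultimately have "hk_eq G ((q @ p) @ [a] @ (p' @ q')) ((p @ q) @ [a] @ (q' @ p'))"
    by (simp only: hk_append)
  then show ?thesis by simp
qed

text \<open>Sorting \<open>u\<close> with \<open>K\<close> last and \<open>v\<close> with
  \<open>K\<close> first gathers the letters of \<open>K\<close> around \<open>a\<close>. The block
  so formed may be replaced by any word equivalent to it.\<close>

lemma hk_cofactor:
  assumes "a \<notin> set u" "a \<notin> set v" "hk_eq G w (u @ a # v)"
  shows "hk_eq G w (s1.letters_in u @ s2.letters_in w @ s1.letters_in v)"
proof -
  have uv: "u \<in> lists (pverts G)" "v \<in> lists (pverts G)"
    using hk_eq_in_lists[OF assms(3)] by auto
  have a: "hk_eq G [a] [a]" using a_in by (auto intro!: hk_refl)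
  have v: "hk_eq G v (s2.letters_in v @ s1.letters_in v)"
    by (rule hk_trans[OF hk_split hk_commute_parts]) (use assms uv in auto)
  have 1: "hk_eq G (u @ [a] @ v)
      ((s1.letters_in u @ s2.letters_in u) @ [a] @ (s2.letters_in v @ s1.letters_in v))"
    by (rule hk_append[OF hk_split[OF uv(1) assms(1)] hk_append[OF a v]])
  have 1: "hk_eq G w (s1.letters_in u @ s2.letters_in (u @ a # v) @ s1.letters_in v)"
    using hk_trans_eq[OF assms(3) 1] a_in by simp
  \<comment> \<open>The inner block is the \<open>K\<close>-part of the normal form; deletion
    respects the congruence, so it is equivalent to the \<open>K\<close>-part of
    \<open>w\<close>.\<close>
  have 2: "hk_eq G (s2.letters_in (u @ a # v)) (s2.letters_in w)"
    by (rule s2.hk_eq_mono[OF s2.hk_eq_letters_in[OF hk_sym[OF assms(3)]]])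
  have "hk_eq G (s1.letters_in u @ s2.letters_in (u @ a # v) @ s1.letters_in v)
      (s1.letters_in u @ s2.letters_in w @ s1.letters_in v)"
    using uv by (intro hk_context[OF 2]) auto
  with 1 show ?thesis by (rule hk_trans)
qed

text \<open>This is injectivity of the map from the monoid of \<open>G\<close> to the product of the
  monoids of \<open>H\<close> and \<open>K\<close>.\<close>

lemma hk_eq_if_parts:
  assumes w: "w \<in> lists (pverts G)" "w' \<in> lists (pverts G)"
    and eqH: "hk_eq H (s1.letters_in w) (s1.letters_in w')"
    and eqK: "hk_eq K (s2.letters_in w) (s2.letters_in w')"
  shows "hk_eq G w w'"
proof (cases "a \<in> set w")
  case False
  then have "a \<notin> set w'" using hk_eq_set[OF eqH] a_in by auto
  then have "hk_eq G w' (s1.letters_in w' @ s2.letters_in w')"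
    using w by (intro hk_split)
  then have 2: "hk_eq G (s1.letters_in w' @ s2.letters_in w') w'" by (rule hk_sym)
  have 1: "hk_eq G w (s1.letters_in w @ s2.letters_in w)"
    using False w by (intro hk_split)
  have "hk_eq G (s1.letters_in w @ s2.letters_in w) (s1.letters_in w' @ s2.letters_in w')"
    by (rule hk_append[OF s1.hk_eq_mono[OF eqH] s2.hk_eq_mono[OF eqK]])
  from hk_trans[OF hk_trans[OF 1 this] 2] show ?thesis .
next
  case True
  then have "a \<in> set w'" using hk_eq_set[OF eqH] a_in by auto
  then obtain u' v' where uv': "a \<notin> set u'" "a \<notin> set v'" "hk_eq G w' (u' @ a # v')"
    using hk_normal_form w by metis
  from True obtain u v where uv: "a \<notin> set u" "a \<notin> set v" "hk_eq G w (u @ a # v)"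
    using hk_normal_form w by metis
  have lists: "u \<in> lists (pverts G)" "v \<in> lists (pverts G)"
    "u' \<in> lists (pverts G)" "v' \<in> lists (pverts G)"
    using hk_eq_in_lists[OF uv(3)] hk_eq_in_lists[OF uv'(3)] by auto
  interpret swap: hk_amalgam G K H a by (rule swap)
  have H: "hk_eq G (s1.letters_in w) (s1.letters_in (u' @ a # v'))"
    by (rule s1.hk_eq_mono[OF hk_trans[OF eqH s1.hk_eq_letters_in[OF uv'(3)]]])
  have K: "hk_eq G (s2.letters_in (u @ a # v)) (s2.letters_in w')"
    by (rule s2.hk_eq_mono[OF hk_trans[OF s2.hk_eq_letters_in[OF hk_sym[OF uv(3)]] eqK]])
  \<comment> \<open>With the \<open>H\<close>-part as inner block, it is replaced by that of
    \<open>w'\<close>; the exchange makes the \<open>K\<close>-part the inner block, which is then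
    replaced in turn, leaving a factorization of \<open>w'\<close>.\<close>
  have "hk_eq G w (s2.letters_in u @ s1.letters_in w @ s2.letters_in v)"
    by (rule swap.hk_cofactor[OF uv])
  also have "hk_eq G \<dots> (s2.letters_in u @ s1.letters_in (u' @ a # v') @ s2.letters_in v)"
    using lists by (intro hk_context[OF H]) auto
  also have "hk_eq G \<dots> (s1.letters_in u' @ s2.letters_in (u @ a # v) @ s1.letters_in v')"
    using hk_exchange[of "s1.letters_in u'" "s1.letters_in v'" "s2.letters_in u" "s2.letters_in v"]
      lists uv uv' a_in by auto
  also have "hk_eq G \<dots> (s1.letters_in u' @ s2.letters_in w' @ s1.letters_in v')"
    using lists by (intro hk_context[OF K]) auto
  also have "hk_eq G \<dots> w'"
    by (rule hk_sym[OF hk_cofactor[OF uv']])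
  finally show ?thesis .
qed

text \<open>If \<open>a\<close> is a source, then \<open>H\<close> spans an invariant submodule; if \<open>a\<close> is a sink, then
  the vertices outside \<open>H\<close> do, and \<open>s1.proj\<close> is the quotient map.\<close>

lemma theta_outside:
  assumes "x \<in> pverts G" "x \<notin> pverts H" "w \<in> free_mod (pverts G)"
    and "(\<forall>y. (a, y) \<notin> parcs G) \<or> w \<in> free_mod (pverts H)"
  shows "s1.proj (theta G f x w) = s1.proj w"
proof
  fix z
  \<comment> \<open>Such an arc forces \<open>z = a\<close>, so \<open>a\<close> is not a sink; then
    \<open>w\<close> is supported on \<open>H\<close> and vanishes at \<open>x\<close>.\<close>
  have "w x = 0" if "z \<in> pverts H" "(z, x) \<in> parcs G"
  proof -
    have "x \<in> pverts K" "x \<noteq> a" using assms verts_union a_in by auto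
    then have "z = a" using no_arc(1)[OF that(1)] that(2) by blast
    then show ?thesis using that assms by (auto simp: s1.sub.fm)
  qed
  then show "s1.proj (theta G f x w) z = s1.proj w z"
    using assms by (auto simp: s1.proj_def theta_apply)
qed

text \<open>An arc entering \<open>H\<close> from outside would have to end at \<open>a\<close>,
  which a source forbids; a letter \<open>x\<close> outside \<open>H\<close> has coefficient 0 in
  \<open>w\<close>.\<close>

lemma theta_in_sub:
  assumes "\<forall>y. (y, a) \<notin> parcs G" "x \<in> pverts G" "w \<in> free_mod (pverts H)"
  shows "theta G f x w \<in> free_mod (pverts H)"
proof -
  have w: "w \<in> free_mod (pverts G)" using assms(3) by (rule s1.free_mod_mono)
  have "w x = 0" if "z \<notin> pverts H" "(z, x) \<in> parcs G" for z
  proof (cases "x \<in> pverts H")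
    case True
    have "z \<in> pverts G" using that(2) by (rule in_arcsD1)
    then have "z \<in> pverts K" "z \<noteq> a" using that(1) a_in verts_union by auto
    then have "x = a" using no_arc(2)[OF True] that(2) by blast
    then show ?thesis using assms(1) that by auto
  qed (use assms in \<open>auto simp: s1.sub.fm\<close>)
  then show ?thesis
    using assms w by (auto simp: s1.sub.fm theta_apply)
qed

text \<open>On vectors supported on \<open>H\<close>, letters outside \<open>H\<close> become
  invisible after projection. Thus the action of \<open>G\<close> determines that of the
  \<open>H\<close>-part of a word.\<close>

lemma proj_word_rep_letters_in:
  fixes f g :: "'v \<times> 'v \<Rightarrow> 'r::comm_ring_1"
  assumes w: "w \<in> free_mod (pverts H)" and agree: "\<And>e. e \<in> parcs H \<Longrightarrow> g e = f e"
  shows "u \<in> lists (pverts G) \<Longrightarrow>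
    s1.proj (word_rep G f u w) = word_rep H g (s1.letters_in u) w"
proof (induction u rule: list.induct)
  case Nil
  then show ?case using w
    by (simp add: word_rep_simps s1.sub.word_rep_simps s1.free_mod_mono s1.proj_id)
next
  case (Cons x u)
  have wG: "w \<in> free_mod (pverts G)" using w by (rule s1.free_mod_mono)
  have rG: "word_rep G f u w \<in> free_mod (pverts G)"
    using Cons wG by (intro word_rep_in_free_mod) auto
  show ?case
  proof (cases "x \<in> pverts H")
    case True
    then show ?thesis using Cons rG
      by (simp add: word_rep_simps wG s1.sub.word_rep_simps w s1.proj_theta[OF _ _ agree])
  next
    case False
    \<comment> \<open>For a source, invariance keeps every intermediate vector in the submodule of
      \<open>H\<close>; for a sink, \<open>theta_outside\<close> applies to any vector.\<close>
    have "word_rep G f v w \<in> free_mod (pverts H)"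
      if "\<forall>y. (y, a) \<notin> parcs G" "v \<in> lists (pverts G)" for v
      using that(2) by (induction v) (auto simp: word_rep_simps wG w intro: theta_in_sub[OF that(1)])
    then have "(\<forall>y. (a, y) \<notin> parcs G) \<or> word_rep G f u w \<in> free_mod (pverts H)"
      using source_or_sink Cons.prems by auto
    then show ?thesis using False Cons rG
      by (simp add: word_rep_simps wG theta_outside)
  qed
qed

text \<open>Only the letter \<open>a\<close> can affect \<open>z\<close>, and only if
  \<open>z -> a\<close>, so that \<open>a\<close> is a sink. The rightmost \<open>a\<close> acts
  first and clears the \<open>a\<close>-coordinate, hence further occurrences add nothing.\<close>

lemma word_rep_outside:
  assumes w: "w \<in> free_mod (pverts G)" and z: "z \<notin> pverts H"
  shows "u \<in> lists (pverts H) \<Longrightarrow> word_rep G f u w z =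
    w z + (if a \<in> set u \<and> (z, a) \<in> parcs G then w a * f (z, a) else 0)"
proof (induction u rule: list.induct)
  case Nil
  then show ?case by (simp add: word_rep_simps w)
next
  case (Cons x u)
  then have x: "x \<in> pverts H" and u: "u \<in> lists (pverts H)" by auto
  then have xG: "x \<in> pverts G" and uG: "u \<in> lists (pverts G)" using verts_union by auto
  have r: "word_rep G f u w \<in> free_mod (pverts G)"
    by (rule word_rep_in_free_mod[OF uG w])
  have xa: "x = a" if "(z, x) \<in> parcs G"
  proof -
    have "z \<in> pverts G" using that by (rule in_arcsD1)
    then have "z \<in> pverts K" "z \<noteq> a" using z a_in verts_union by auto
    then show ?thesis using no_arc(2)[OF x] that by blast
  qed
  have "word_rep G f u w a = (if a \<in> set u then 0 else w a)" if "(z, a) \<in> parcs G"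
    using that source_or_sink by (intro word_rep_sink_coord w uG) auto
  then show ?case
    using Cons.IH[OF u] z x xa by (auto simp: word_rep_simps w theta_apply[OF r xG])
qed

section \<open>Transfer of effectiveness between \<open>G\<close> and its parts\<close>

lemma effective_part:
  fixes f g :: "'v \<times> 'v \<Rightarrow> 'r::comm_ring_1"
  assumes "effective G f" and agree: "\<And>e. e \<in> parcs H \<Longrightarrow> g e = f e"
  shows "effective H g"
  unfolding effective_iff[OF s1.oriented_sub]
proof (intro ballI impI)
  fix u v
  assume uv: "u \<in> lists (pverts H)" "v \<in> lists (pverts H)"
    and eq: "word_rep H g u = word_rep H g v"
  have uvG: "u \<in> lists (pverts G)" "v \<in> lists (pverts G)" using uv verts_union by auto
  \<comment> \<open>An arc \<open>z -> a\<close> makes \<open>a\<close> a sink. The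
    \<open>a\<close>-coordinate of the image of \<open>basis_vec a\<close> is then 0 or 1 according
    to whether \<open>a\<close> occurs.\<close>
  have a_iff: "a \<in> set u \<longleftrightarrow> a \<in> set v" if "(z, a) \<in> parcs G" for z
  proof -
    have sink: "\<And>y. (a, y) \<notin> parcs H" using source_or_sink that by (auto simp: s1.sub_arcs)
    have "word_rep H g w (basis_vec a) a = (if a \<in> set w then 0 else 1)"
      if "w \<in> lists (pverts H)" for w
      unfolding s1.sub.word_rep_sink_coord[OF sink basis_vec_in_free_mod[OF a_in(2)] that]
      by (simp add: basis_vec_def)
    from this[OF uv(1)] this[OF uv(2)]
    have "(if a \<in> set u then 0 else 1 :: 'r) = (if a \<in> set v then 0 else 1)"
      unfolding eq by simp
    then show ?thesis by (simp split: if_splits)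
  qed
  have "word_rep G f u = word_rep G f v"
  proof (rule word_rep_eqI[OF uvG], rule ext)
    fix w :: "'v \<Rightarrow> 'r" and z
    assume w: "w \<in> free_mod (pverts G)"
    show "word_rep G f u w z = word_rep G f v w z"
    proof (cases "z \<in> pverts H")
      case True
      have "s1.proj (word_rep G f u w) = s1.proj (word_rep G f v w)"
        using s1.proj_word_rep[where f = f and g = g, OF w agree uv(1)]
          s1.proj_word_rep[where f = f and g = g, OF w agree uv(2)]
        unfolding eq by simp
      from fun_cong[OF this, of z] True show ?thesis by (simp add: s1.proj_def)
    next
      case False
      show ?thesis
        unfolding word_rep_outside[OF w False uv(1)] word_rep_outside[OF w False uv(2)]
        using a_iff by auto
    qed
  qed
  then have "hk_eq G u v"
    using effective_iff[OF oriented_digraph_axioms, THEN iffD1, OF assms(1)] uvG by blast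
  then have "hk_eq H (s1.letters_in u) (s1.letters_in v)" by (rule s1.hk_eq_letters_in)
  moreover have "s1.letters_in u = u" "s1.letters_in v = v" using uv by (auto simp: filter_id_conv)
  ultimately show "hk_eq H u v" by simp
qed

lemma hk_eq_letters_in_if_word_rep_eq:
  fixes f g :: "'v \<times> 'v \<Rightarrow> 'r::comm_ring_1"
  assumes "effective H g" and agree: "\<And>e. e \<in> parcs H \<Longrightarrow> g e = f e"
    and uv: "u \<in> lists (pverts G)" "v \<in> lists (pverts G)"
    and eq: "word_rep G f u = word_rep G f v"
  shows "hk_eq H (s1.letters_in u) (s1.letters_in v)"
proof -
  have "word_rep H g (s1.letters_in u) = word_rep H g (s1.letters_in v)"
  proof (rule s1.sub.word_rep_eqI)
    fix w :: "'v \<Rightarrow> 'r"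
    assume "w \<in> free_mod (pverts H)"
    then show "word_rep H g (s1.letters_in u) w = word_rep H g (s1.letters_in v) w"
      using proj_word_rep_letters_in[where f = f and g = g, OF _ agree uv(1)]
        proj_word_rep_letters_in[where f = f and g = g, OF _ agree uv(2)]
      by (simp add: eq)
  qed simp_all
  then show ?thesis
    using effective_iff[OF s1.oriented_sub, THEN iffD1, OF assms(1)] s1.letters_in_lists by blast
qed

lemma effective_amalgam_iff:
  fixes f g h :: "'v \<times> 'v \<Rightarrow> 'r::comm_ring_1"
  assumes g: "\<And>e. e \<in> parcs H \<Longrightarrow> g e = f e" and h: "\<And>e. e \<in> parcs K \<Longrightarrow> h e = f e"
  shows "effective G f \<longleftrightarrow> effective H g \<and> effective K h"
proof
  interpret swap: hk_amalgam G K H a by (rule swap)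
  show "effective H g \<and> effective K h" if "effective G f"
    using effective_part[OF that g] swap.effective_part[OF that h] by simp
  show "effective G f" if eff: "effective H g \<and> effective K h"
    unfolding effective_iff[OF oriented_digraph_axioms]
  proof (intro ballI impI)
    fix u v
    assume *: "u \<in> lists (pverts G)" "v \<in> lists (pverts G)" "word_rep G f u = word_rep G f v"
    show "hk_eq G u v"
      using hk_eq_letters_in_if_word_rep_eq[OF _ g *] swap.hk_eq_letters_in_if_word_rep_eq[OF _ h *]
        hk_eq_if_parts[OF *(1,2)] eff by simp
  qed
qed

end

theorem theorem4p5:
  fixes G G1 G2 :: "'v pair_pre_digraph"
    and a :: 'v
    and f f1 f2 :: "'v \<times> 'v \<Rightarrow> 'r::idom"
  assumes "oriented_digraph G"
    and "induced_subgraph (with_proj G1) (with_proj G)"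
    and "induced_subgraph (with_proj G2) (with_proj G)"
    and "with_proj G = Digraph_Component.union (with_proj G1) (with_proj G2)"
    and "pverts G1 \<inter> pverts G2 = {a}"
    and "is_source G a \<or> is_sink G a"
    and "f1 \<in> weight_fun G1"
    and "f2 \<in> weight_fun G2"
    and "f \<in> weight_fun G"
    and "restrict f (parcs G1) = f1"
    and "restrict f (parcs G2) = f2"
  shows "effective G f \<longleftrightarrow> effective G1 f1 \<and> effective G2 f2"
proof -
  interpret oriented_digraph G by (rule assms)
  have union: "pverts G = pverts G1 \<union> pverts G2" "parcs G = parcs G1 \<union> parcs G2"
    using arg_cong[OF assms(4), of verts] arg_cong[OF assms(4), of arcs]
    by (simp_all add: Digraph_Component.union_def)
  have sub: "pverts G1 \<subseteq> pverts G" "pverts G2 \<subseteq> pverts G"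
    using union(1) by simp_all
  have "parcs G1 = {e \<in> parcs G. fst e \<in> pverts G1 \<and> snd e \<in> pverts G1}"
    "parcs G2 = {e \<in> parcs G. fst e \<in> pverts G2 \<and> snd e \<in> pverts G2}"
    using assms(2,3) by (simp_all add: induced_subgraph_def)
  from this[THEN eqset_imp_iff] have arcs:
    "\<And>x y. (x, y) \<in> parcs G1 \<longleftrightarrow> (x, y) \<in> parcs G \<and> x \<in> pverts G1 \<and> y \<in> pverts G1"
    "\<And>x y. (x, y) \<in> parcs G2 \<longleftrightarrow> (x, y) \<in> parcs G \<and> x \<in> pverts G2 \<and> y \<in> pverts G2"
    by simp_all
  have a: "(\<forall>y. (y, a) \<notin> parcs G) \<or> (\<forall>y. (a, y) \<notin> parcs G)"
    using assms(6) by (auto simp: is_source_def is_sink_def in_arcs_def out_arcs_def)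
  interpret hk_amalgam G G1 G2 a
    by unfold_locales (fact sub arcs union assms(5) a)+
  show ?thesis
    \<comment> \<open>Rewriting \<open>f1\<close> and \<open>f2\<close> as restrictions of
      \<open>f\<close> gives the required agreement on the arcs of each part.\<close>
    using effective_amalgam_iff[of f1 f f2] assms(10,11)[symmetric] by simp
qed

end
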